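(* The Grötzsch graph is not a veto interval graph.
   Context: The Grötzsch graph is the 11-vertex triangle-free graph with chromatic number 4 obtained as the Mycielskian of the 5-cycle: vertices $a,b,c,d,e$ forming the cycle $abcdea$, vertices $f,g,h,i,j$ where each of these is adjacent to the two cycle-neighbours of a corresponding cycle vertex (the "shadow" vertices), and a vertex $k$ adjacent to all of $f,g,h,i,j$. A veto interval is a triple $I(a)=(a_l,a_v,a_r)$ of reals with $a_l<a_v<a_r$. A veto interval representation of a graph $G$ assigns to each vertex $a$ a veto interval $I(a)$ such that distinct vertices $a,b$ are adjacent if and only if $a_v<b_l<a_r<b_v$ or $b_v<a_l<b_r<a_v$. A graph is a veto interval graph if it has such a representation. *)

theory Defs
  imports Complex_Main "Graph_Theory.Pair_Digraph"
begin

record veto_interval =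
  lft :: real
  veto :: real
  rgt :: real

definition valid_veto_interval :: "veto_interval \<Rightarrow> bool" where
  "valid_veto_interval x \<longleftrightarrow> lft x < veto x \<and> veto x < rgt x"

definition veto_adjacent :: "veto_interval \<Rightarrow> veto_interval \<Rightarrow> bool" where
  "veto_adjacent x y \<longleftrightarrow>
     (veto x < lft y \<and> lft y < rgt x \<and> rgt x < veto y) \<or>
     (veto y < lft x \<and> lft x < rgt y \<and> rgt y < veto x)"

text \<open>Undirected graphs are symmetric, loop-free pair digraphs (locale \<open>pair_graph\<close>).\<close>

definition veto_interval_representation ::
    "'v pair_pre_digraph \<Rightarrow> ('v \<Rightarrow> veto_interval) \<Rightarrow> bool" where
  "veto_interval_representation G I \<longleftrightarrow>
     (\<forall>u \<in> pverts G. valid_veto_interval (I u)) \<and>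
     (\<forall>u \<in> pverts G. \<forall>v \<in> pverts G. u \<noteq> v \<longrightarrow>
        ((u, v) \<in> parcs G \<longleftrightarrow> veto_adjacent (I u) (I v)))"

definition veto_interval_graph :: "'v pair_pre_digraph \<Rightarrow> bool" where
  "veto_interval_graph G \<longleftrightarrow> (\<exists>I. veto_interval_representation G I)"

datatype grotzsch_vertex = Va | Vb | Vc | Vd | Ve | Vf | Vg | Vh | Vi | Vj | Vk

text \<open>
  \<open>Vf\<close>, \<open>Vg\<close>, \<open>Vh\<close>, \<open>Vi\<close>, \<open>Vj\<close> are the shadows of \<open>Va\<close>, \<open>Vb\<close>, \<open>Vc\<close>, \<open>Vd\<close>, \<open>Ve\<close>
  respectively. Each edge is listed once here, in an arbitrary direction.
\<close>

definition grotzsch_edges :: "(grotzsch_vertex \<times> grotzsch_vertex) set" where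
  "grotzsch_edges =
     {(Va, Vb), (Vb, Vc), (Vc, Vd), (Vd, Ve), (Ve, Va)} \<union>
     {(Vf, Ve), (Vf, Vb), (Vg, Va), (Vg, Vc), (Vh, Vb), (Vh, Vd),
      (Vi, Vc), (Vi, Ve), (Vj, Vd), (Vj, Va)} \<union>
     {(Vk, Vf), (Vk, Vg), (Vk, Vh), (Vk, Vi), (Vk, Vj)}"

definition grotzsch_graph :: "grotzsch_vertex pair_pre_digraph" where
  "grotzsch_graph = \<lparr> pverts = UNIV, parcs = grotzsch_edges \<union> grotzsch_edges\<inverse> \<rparr>"

lemma UNIV_grotzsch_vertex:
  "UNIV = {Va, Vb, Vc, Vd, Ve, Vf, Vg, Vh, Vi, Vj, Vk}"
  using grotzsch_vertex.exhaust by blast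

lemma pair_graph_grotzsch: "pair_graph grotzsch_graph"
proof
  show "finite (pverts grotzsch_graph)"
    by (simp add: grotzsch_graph_def UNIV_grotzsch_vertex)
  show "finite (parcs grotzsch_graph)"
    by (simp add: grotzsch_graph_def grotzsch_edges_def)
  show "symmetric (with_proj grotzsch_graph)"
    by (auto simp: symmetric_def grotzsch_graph_def arcs_ends_def arc_to_ends_def intro!: symI)
qed (auto simp: grotzsch_graph_def grotzsch_edges_def)

lemma grotzsch_triangle_free:
  assumes "(u, v) \<in> parcs grotzsch_graph" "(v, w) \<in> parcs grotzsch_graph"
  shows "(u, w) \<notin> parcs grotzsch_graph"
  using assms
  by (cases u; cases v; simp add: grotzsch_graph_def grotzsch_edges_def; cases w; simp)

end

(* A representation is a solution of a finite system of order constraints on 33 real endpoints: a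
   Boolean combination of strict inequalities for each vertex and each pair of vertices. This
   system is already contradictory in linear arithmetic. *)
theory Submission
  imports Defs
begin

theorem theorem12:
  shows "\<not> veto_interval_graph grotzsch_graph"
proof
  assume "veto_interval_graph grotzsch_graph"
  then obtain I where rep: "veto_interval_representation grotzsch_graph I"
    unfolding veto_interval_graph_def by blast
  \<comment> \<open>The range \<open>UNIV\<close> stays explicit here and in \<open>adj\<close> so
    that \<open>UNIV_grotzsch_vertex\<close> can later turn the quantifiers into conjunctions over
    the eleven vertices.\<close>
  have valid: "\<forall>u \<in> UNIV. lft (I u) < veto (I u) \<and> veto (I u) < rgt (I u)"
    using rep
    by (simp add: veto_interval_representation_def valid_veto_interval_def grotzsch_graph_def)
  have adj: "\<forall>u \<in> UNIV. \<forall>v \<in> UNIV. u \<noteq> v \<longrightarrow>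
      (veto_adjacent (I u) (I v) \<longleftrightarrow> (u, v) \<in> grotzsch_edges \<or> (v, u) \<in> grotzsch_edges)"
    using rep by (auto simp: veto_interval_representation_def grotzsch_graph_def)
  \<comment> \<open>Edge membership is decided for each pair before \<open>veto_adjacent\<close> is
    expanded: every ordered pair of distinct vertices leaves one adjacency condition, asserted or
    negated, in which only comparisons of real endpoints occur.\<close>
  show False
    using valid[unfolded UNIV_grotzsch_vertex, simplified]
      adj[unfolded UNIV_grotzsch_vertex grotzsch_edges_def, simplified,
        unfolded veto_adjacent_def]
    by (smt (z3))
qed

end
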